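(* Let $d\ge 1$, let $\Omega\subset\mathbb{R}^d$ be a bounded open set, let $\theta\in\mathbb{S}^{d-1}$, let $u\in W_\theta(\Omega)$, and let $g$ be a directional trace of $u$ in the direction $\theta$. Then a function $\widetilde g:\partial\Omega\to\mathbb{R}$ is a directional trace of $u$ in the direction $\theta$ if and only if $\widetilde g(z)=g(z)$ for $\mu_\theta$-a.e. $z\in\partial\Omega$. As a consequence, the directional trace $\gamma_\theta u$ of $u$ in the direction $\theta$ (the set of all directional traces of $u$ in the direction $\theta$) is an equivalence class, for the relation of equality $\mu_\theta$-a.e., of a function measurable for the Borel $\sigma$-algebra.
   Context: $\partial\Omega=\overline{\Omega}\setminus\Omega$; $\mathbb{S}^{d-1}$ is the Euclidean unit sphere of $\mathbb{R}^d$; $]a,b[$ denotes the open real interval. A function $u\in L^2(\Omega)$ has weak directional derivative $\partial_\theta u=v\in L^2(\Omega)$ if $\int_\Omega u\,(\theta\cdot\nabla\varphi)\,dx=-\int_\Omega v\varphi\,dx$ for all $\varphi\in C^\infty_c(\Omega)$. $W_\theta(\Omega)=\{u\in L^2(\Omega):\partial_\theta u\in L^2(\Omega)\}$. $H_\theta=\{y\in\mathbb{R}^d: y\cdot\theta=0\}$; $\mathcal{P}_\theta(x)=x-(x\cdot\theta)\theta$; $\lambda^{d-1}$ is the $(d-1)$-dimensional Lebesgue measure on $H_\theta$ (identified isometrically with $\mathbb{R}^{d-1}$). For $y\in H_\theta$, $\omega_\theta(y)=\{s\in\mathbb{R}: s\theta+y\in\Omega\}$, an open subset of $\mathbb{R}$,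 and $\mathcal{I}_\theta(y)$ is the countable set of disjoint bounded open intervals (the connected components) whose union is $\omega_\theta(y)$. Directional trace: a function $g:\partial\Omega\to\mathbb{R}$ is a directional trace of $u\in W_\theta(\Omega)$ in the direction $\theta$ if there exist a representative of $u$ (still denoted $u$) and a set $A\subset\mathcal{P}_\theta(\Omega)$ such that (1) $\mathcal{P}_\theta(\Omega)\setminus A$ is $\lambda^{d-1}$-negligible; (2) for all $y\in A$, $u_{\theta,y}:s\mapsto u(s\theta+y)$ is an element of $H^1(\omega_\theta(y))$ and, for all $]\alpha,\beta[\,\in\mathcal{I}_\theta(y)$, taking the representative of $u_{\theta,y}$ which is continuous on $]\alpha,\beta]$, one has $g(\beta\theta+y)=u_{\theta,y}(\beta)$. Directional measure: for $x\in\Omega$, $\delta_\theta(x)=\sup\{s\ge 0:\forall t\in[0,s[,\ x+t\theta\in\Omega\}$ and $\Phi_\theta(x)=x+\delta_\theta(x)\theta\in\partial\Omega$. The finite Borel measure $\mu_\theta$ on $\partial\Omega$ is $\mu_\theta(A)=\int_\Omega\chi_A(\Phi_\theta(x))\,dx$ for all Borel $A\subset\partial\Omega$. A set is $\mu_\theta$-negligible if it is contained in a Borel set of $\mu_\theta$-measure $0$. *)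

theory Defs
  imports "HOL-Analysis.Analysis"
begin

section \<open>Square-integrable functions and weak directional derivatives\<close>

text \<open>Elements of \<open>L\<^sup>2(\<Omega>)\<close> are given by functions on the whole type whose values outside \<open>\<Omega>\<close>
  are irrelevant; representatives are compared almost everywhere on \<open>\<Omega>\<close>.\<close>

definition L2 :: "'a::euclidean_space set \<Rightarrow> ('a \<Rightarrow> real) set" where
  "L2 \<Omega> = {u. u \<in> borel_measurable (lebesgue_on \<Omega>) \<and> integrable (lebesgue_on \<Omega>) (\<lambda>x. (u x)\<^sup>2)}"

primrec Ck :: "nat \<Rightarrow> ('a::euclidean_space \<Rightarrow> real) \<Rightarrow> bool" where
  "Ck 0 f \<longleftrightarrow> continuous_on UNIV f"
| "Ck (Suc k) f \<longleftrightarrow>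
     (\<forall>x. f differentiable (at x)) \<and> (\<forall>b\<in>Basis. Ck k (\<lambda>x. frechet_derivative f (at x) b))"

text \<open>\<open>C\<^sub>c\<^sup>\<infinity>(\<Omega>)\<close>; test functions are extended by \<open>0\<close> to the whole space.\<close>

definition test_functions :: "'a::euclidean_space set \<Rightarrow> ('a \<Rightarrow> real) set" where
  "test_functions \<Omega> =
     {\<phi>. (\<forall>k. Ck k \<phi>) \<and> compact (closure {x. \<phi> x \<noteq> 0}) \<and> closure {x. \<phi> x \<noteq> 0} \<subseteq> \<Omega>}"

definition grad :: "('a::euclidean_space \<Rightarrow> real) \<Rightarrow> 'a \<Rightarrow> 'a" where
  "grad \<phi> x = (\<Sum>b\<in>Basis. frechet_derivative \<phi> (at x) b *\<^sub>R b)"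

definition has_weak_dir_deriv ::
    "'a::euclidean_space \<Rightarrow> 'a set \<Rightarrow> ('a \<Rightarrow> real) \<Rightarrow> ('a \<Rightarrow> real) \<Rightarrow> bool" where
  "has_weak_dir_deriv \<theta> \<Omega> u v \<longleftrightarrow>
     (\<forall>\<phi>\<in>test_functions \<Omega>.
        (\<integral>x. u x * (\<theta> \<bullet> grad \<phi> x) \<partial>lebesgue_on \<Omega>) = - (\<integral>x. v x * \<phi> x \<partial>lebesgue_on \<Omega>))"

definition W :: "'a::euclidean_space \<Rightarrow> 'a set \<Rightarrow> ('a \<Rightarrow> real) set" where
  "W \<theta> \<Omega> = {u \<in> L2 \<Omega>. \<exists>v\<in>L2 \<Omega>. has_weak_dir_deriv \<theta> \<Omega> u v}"

text \<open>In dimension one, \<open>1 \<bullet> grad \<phi> s\<close> is \<open>\<phi>'(s)\<close>, so the following is the usual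
  Sobolev space \<open>H\<^sup>1\<close> of an open subset of the real line.\<close>

definition H1 :: "real set \<Rightarrow> (real \<Rightarrow> real) set" where
  "H1 \<omega> = W 1 \<omega>"


section \<open>Slicing in the direction \<open>\<theta>\<close>\<close>

definition hyperplane :: "'a::euclidean_space \<Rightarrow> 'a set" where
  "hyperplane \<theta> = {y. y \<bullet> \<theta> = 0}"

definition proj :: "'a::euclidean_space \<Rightarrow> 'a \<Rightarrow> 'a" where
  "proj \<theta> x = x - (x \<bullet> \<theta>) *\<^sub>R \<theta>"

definition is_onb :: "'a::euclidean_space set \<Rightarrow> 'a set \<Rightarrow> bool" where
  "is_onb B V \<longleftrightarrow> B \<subseteq> V \<and> span B = V \<and> pairwise orthogonal B \<and> (\<forall>b\<in>B. norm b = 1)"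

lemma ex_onb_hyperplane: "\<exists>B. is_onb B (hyperplane \<theta>)"
proof -
  have "subspace (hyperplane \<theta>)"
    unfolding hyperplane_def by (rule subspace_hyperplane2)
  from orthonormal_basis_subspace[OF this] show ?thesis
    unfolding is_onb_def by metis
qed

text \<open>The \<open>(d-1)\<close>-dimensional Lebesgue measure on the hyperplane, obtained by transporting the
  product Lebesgue measure along the coordinates of an orthonormal basis, exactly as \<open>lborel\<close> is
  built from \<open>Basis\<close>. By invariance of Lebesgue measure under isometries the choice of the basis
  is immaterial. If \<open>d = 1\<close> the basis is empty and the measure is the unit mass on \<open>{0}\<close>.\<close>

definition hyperplane_measure :: "'a::euclidean_space \<Rightarrow> 'a measure" where
  "hyperplane_measure \<theta> =
     (let B = (SOME B. is_onb B (hyperplane \<theta>))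
      in distr (Pi\<^sub>M B (\<lambda>_. lborel)) (restrict_space borel (hyperplane \<theta>))
           (\<lambda>c. \<Sum>b\<in>B. c b *\<^sub>R b))"

definition slice :: "'a::euclidean_space \<Rightarrow> 'a set \<Rightarrow> 'a \<Rightarrow> real set" where
  "slice \<theta> \<Omega> y = {s. s *\<^sub>R \<theta> + y \<in> \<Omega>}"


section \<open>Directional traces\<close>

text \<open>Functions on \<open>\<partial>\<Omega>\<close> are total functions of which only the values on \<open>frontier \<Omega>\<close> matter; for
  open \<open>\<Omega>\<close>, \<open>frontier \<Omega> = closure \<Omega> - \<Omega>\<close>. Below, \<open>u'\<close> is the chosen representative of \<open>u\<close>, and
  \<open>w\<close> the representative of its slice that is continuous up to the exit end \<open>\<beta>\<close>. An interval
  \<open>{\<alpha><..<\<beta>}\<close> that is a component is automatically nonempty.\<close>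

definition is_dir_trace ::
    "'a::euclidean_space \<Rightarrow> 'a set \<Rightarrow> ('a \<Rightarrow> real) \<Rightarrow> ('a \<Rightarrow> real) \<Rightarrow> bool" where
  "is_dir_trace \<theta> \<Omega> u g \<longleftrightarrow>
     (\<exists>u' A. (AE x in lebesgue_on \<Omega>. u' x = u x) \<and>
        A \<subseteq> proj \<theta> ` \<Omega> \<and>
        proj \<theta> ` \<Omega> - A \<in> null_sets (completion (hyperplane_measure \<theta>)) \<and>
        (\<forall>y\<in>A.
           (\<lambda>s. u' (s *\<^sub>R \<theta> + y)) \<in> H1 (slice \<theta> \<Omega> y) \<and>
           (\<forall>\<alpha> \<beta>. {\<alpha><..<\<beta>} \<in> components (slice \<theta> \<Omega> y) \<longrightarrow>
              (\<exists>w. continuous_on {\<alpha><..\<beta>} w \<and>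
                   (AE s in lebesgue_on {\<alpha><..<\<beta>}. w s = u' (s *\<^sub>R \<theta> + y)) \<and>
                   g (\<beta> *\<^sub>R \<theta> + y) = w \<beta>))))"

definition dir_trace ::
    "'a::euclidean_space \<Rightarrow> 'a set \<Rightarrow> ('a \<Rightarrow> real) \<Rightarrow> ('a \<Rightarrow> real) set" where
  "dir_trace \<theta> \<Omega> u = {g. is_dir_trace \<theta> \<Omega> u g}"


section \<open>The directional measure\<close>

definition exit_time :: "'a::euclidean_space \<Rightarrow> 'a set \<Rightarrow> 'a \<Rightarrow> real" where
  "exit_time \<theta> \<Omega> x = Sup {s. 0 \<le> s \<and> (\<forall>t\<in>{0..<s}. x + t *\<^sub>R \<theta> \<in> \<Omega>)}"

definition exit_point :: "'a::euclidean_space \<Rightarrow> 'a set \<Rightarrow> 'a \<Rightarrow> 'a" where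
  "exit_point \<theta> \<Omega> x = x + exit_time \<theta> \<Omega> x *\<^sub>R \<theta>"

definition dir_measure :: "'a::euclidean_space \<Rightarrow> 'a set \<Rightarrow> 'a measure" where
  "dir_measure \<theta> \<Omega> =
     distr (lebesgue_on \<Omega>) (restrict_space borel (frontier \<Omega>)) (exit_point \<theta> \<Omega>)"

text \<open>\<open>distr\<close> is only meaningful for measurable maps; the following lemmas show that the exit map
  is one, and that \<open>dir_measure\<close> is given by the integral of \<open>\<chi>\<^sub>A \<circ> \<Phi>\<^sub>\<theta>\<close> over \<open>\<Omega>\<close>.\<close>

context
  fixes \<Omega> :: "'a::euclidean_space set" and \<theta> :: 'a
  assumes op: "open \<Omega>" and bd: "bounded \<Omega>" and nt: "norm \<theta> = 1"
begin

lemma exit_time_set_bdd: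
  assumes "x \<in> \<Omega>"
  shows "bdd_above {s. 0 \<le> s \<and> (\<forall>t\<in>{0..<s}. x + t *\<^sub>R \<theta> \<in> \<Omega>)}" (is "bdd_above ?S")
proof -
  obtain M where M: "\<And>z. z \<in> \<Omega> \<Longrightarrow> norm z \<le> M"
    using bd unfolding bounded_iff by blast
  have "s \<le> 2 * M + 1" if s: "s \<in> ?S" for s
  proof (rule ccontr)
    assume "\<not> s \<le> 2 * M + 1"
    moreover have M0: "0 \<le> M" using M[OF assms] norm_ge_zero[of x] by linarith
    ultimately have "x + (2 * M + 1) *\<^sub>R \<theta> \<in> \<Omega>" using s by auto
    then have "norm (x + (2 * M + 1) *\<^sub>R \<theta>) \<le> M" by (rule M)
    moreover have "norm ((2 * M + 1) *\<^sub>R \<theta>) \<le> norm (x + (2 * M + 1) *\<^sub>R \<theta>) + norm x"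
      by (metis add_diff_cancel_left' norm_triangle_ineq4)
    ultimately show False using M[OF assms] nt M0 by simp
  qed
  then show ?thesis by (rule bdd_aboveI)
qed

lemma less_exit_time_iff:
  assumes x: "x \<in> \<Omega>" and a: "0 \<le> a"
  shows "a < exit_time \<theta> \<Omega> x \<longleftrightarrow> (\<forall>t\<in>{0..a}. x + t *\<^sub>R \<theta> \<in> \<Omega>)"
proof
  let ?S = "{s. 0 \<le> s \<and> (\<forall>t\<in>{0..<s}. x + t *\<^sub>R \<theta> \<in> \<Omega>)}"
  assume "a < exit_time \<theta> \<Omega> x"
  moreover have "?S \<noteq> {}" by (auto intro: exI[of _ 0])
  ultimately obtain s where "s \<in> ?S" "a < s"
    unfolding exit_time_def using exit_time_set_bdd[OF x] by (auto simp: less_cSup_iff)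
  then show "\<forall>t\<in>{0..a}. x + t *\<^sub>R \<theta> \<in> \<Omega>" by auto
next
  let ?S = "{s. 0 \<le> s \<and> (\<forall>t\<in>{0..<s}. x + t *\<^sub>R \<theta> \<in> \<Omega>)}"
  assume seg: "\<forall>t\<in>{0..a}. x + t *\<^sub>R \<theta> \<in> \<Omega>"
  then have "x + a *\<^sub>R \<theta> \<in> \<Omega>" using a by auto
  then obtain e where e: "e > 0" "ball (x + a *\<^sub>R \<theta>) e \<subseteq> \<Omega>"
    using op by (auto elim: openE)
  have "x + t *\<^sub>R \<theta> \<in> \<Omega>" if t: "t \<in> {0..<a + e}" for t
  proof (cases "t \<le> a")
    case False
    have "dist (x + a *\<^sub>R \<theta>) (x + t *\<^sub>R \<theta>) = norm ((a - t) *\<^sub>R \<theta>)"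
      by (simp add: dist_norm algebra_simps)
    also have "\<dots> < e" using False t nt by simp
    finally show ?thesis using e by auto
  qed (use seg t in auto)
  then have "a + e \<in> ?S" using a e by auto
  then have "a + e \<le> exit_time \<theta> \<Omega> x"
    unfolding exit_time_def using exit_time_set_bdd[OF x] by (rule cSup_upper)
  then show "a < exit_time \<theta> \<Omega> x" using e by simp
qed

lemma exit_time_pos: "x \<in> \<Omega> \<Longrightarrow> 0 < exit_time \<theta> \<Omega> x"
  by (subst less_exit_time_iff) auto

lemma exit_time_measurable: "exit_time \<theta> \<Omega> \<in> borel_measurable (restrict_space borel \<Omega>)"
proof (rule borel_measurableI_greater)
  fix a :: real
  let ?sp = "space (restrict_space borel \<Omega>)"
  have "open {x \<in> \<Omega>. a < exit_time \<theta> \<Omega> x}"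
  proof (cases "0 \<le> a")
    case False
    then have "{x \<in> \<Omega>. a < exit_time \<theta> \<Omega> x} = \<Omega>" using exit_time_pos by force
    then show ?thesis using op by simp
  next
    case True
    let ?K = "(\<lambda>t. t *\<^sub>R \<theta>) ` {0..a}"
    have "compact ?K" by (intro compact_continuous_image continuous_intros) auto
    with op have "closed (\<Union>z\<in>-\<Omega>. \<Union>k\<in>?K. {z - k})"
      by (intro closed_compact_differences) auto
    moreover have "{x \<in> \<Omega>. a < exit_time \<theta> \<Omega> x} = - (\<Union>z\<in>-\<Omega>. \<Union>k\<in>?K. {z - k})"
    proof (rule set_eqI)
      fix x
      have "x \<in> (\<Union>z\<in>-\<Omega>. \<Union>k\<in>?K. {z - k}) \<longleftrightarrow> (\<exists>t\<in>{0..a}. x + t *\<^sub>R \<theta> \<notin> \<Omega>)"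
      proof
        assume "x \<in> (\<Union>z\<in>-\<Omega>. \<Union>k\<in>?K. {z - k})"
        then obtain z t where "z \<notin> \<Omega>" "t \<in> {0..a}" "x = z - t *\<^sub>R \<theta>" by blast
        then show "\<exists>t\<in>{0..a}. x + t *\<^sub>R \<theta> \<notin> \<Omega>" by (intro bexI[of _ t]) simp_all
      next
        assume "\<exists>t\<in>{0..a}. x + t *\<^sub>R \<theta> \<notin> \<Omega>"
        then obtain t where t: "t \<in> {0..a}" "x + t *\<^sub>R \<theta> \<in> - \<Omega>" by blast
        moreover have "x = (x + t *\<^sub>R \<theta>) - t *\<^sub>R \<theta>" by simp
        ultimately show "x \<in> (\<Union>z\<in>-\<Omega>. \<Union>k\<in>?K. {z - k})" by blast
      qed
      moreover have "x \<in> \<Omega>" if "\<forall>t\<in>{0..a}. x + t *\<^sub>R \<theta> \<in> \<Omega>"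
        using bspec[OF that, of 0] True by simp
      ultimately show "x \<in> {x \<in> \<Omega>. a < exit_time \<theta> \<Omega> x} \<longleftrightarrow>
          x \<in> - (\<Union>z\<in>-\<Omega>. \<Union>k\<in>?K. {z - k})"
        using less_exit_time_iff[of x, OF _ True] unfolding mem_Collect_eq Compl_iff by metis
    qed
    ultimately show ?thesis by (simp add: open_closed)
  qed
  moreover have "{x \<in> ?sp. a < exit_time \<theta> \<Omega> x} = \<Omega> \<inter> {x \<in> \<Omega>. a < exit_time \<theta> \<Omega> x}"
    by (auto simp: space_restrict_space)
  ultimately show "{x \<in> ?sp. a < exit_time \<theta> \<Omega> x} \<in> sets (restrict_space borel \<Omega>)"
    unfolding sets_restrict_space by (metis borel_open imageI)
qed

lemma exit_point_in_frontier:
  assumes x: "x \<in> \<Omega>"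
  shows "exit_point \<theta> \<Omega> x \<in> frontier \<Omega>"
proof -
  let ?d = "exit_time \<theta> \<Omega> x"
  have d: "0 < ?d" by (rule exit_time_pos[OF x])
  have inside: "x + t *\<^sub>R \<theta> \<in> \<Omega>" if "0 \<le> t" "t < ?d" for t
    using that less_exit_time_iff[OF x that(1)] by auto
  have "exit_point \<theta> \<Omega> x \<notin> \<Omega>"
  proof
    assume "exit_point \<theta> \<Omega> x \<in> \<Omega>"
    then have "\<forall>t\<in>{0..?d}. x + t *\<^sub>R \<theta> \<in> \<Omega>"
      using inside unfolding exit_point_def by (metis atLeastAtMost_iff less_eq_real_def)
    then show False using less_exit_time_iff[OF x, of ?d] d by simp
  qed
  moreover have "exit_point \<theta> \<Omega> x \<in> closure \<Omega>"
  proof (unfold closure_approachable, intro allI impI)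
    fix e :: real assume e: "0 < e"
    define t where "t = max 0 (?d - e / 2)"
    have t: "0 \<le> t" "t < ?d" "?d - t < e" using e d by (auto simp: t_def)
    have "dist (x + t *\<^sub>R \<theta>) (exit_point \<theta> \<Omega> x) = norm ((t - ?d) *\<^sub>R \<theta>)"
      by (simp add: exit_point_def dist_norm algebra_simps)
    then have "dist (x + t *\<^sub>R \<theta>) (exit_point \<theta> \<Omega> x) < e" using t nt by simp
    then show "\<exists>y\<in>\<Omega>. dist y (exit_point \<theta> \<Omega> x) < e" using inside t by blast
  qed
  ultimately show ?thesis using op by (simp add: frontier_def interior_open)
qed

lemma exit_point_measurable:
  "exit_point \<theta> \<Omega> \<in> lebesgue_on \<Omega> \<rightarrow>\<^sub>M restrict_space borel (frontier \<Omega>)"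
proof (rule measurable_restrict_space2)
  show "exit_point \<theta> \<Omega> \<in> space (lebesgue_on \<Omega>) \<rightarrow> frontier \<Omega>"
    using exit_point_in_frontier by (auto simp: space_restrict_space)
  have [measurable]: "exit_time \<theta> \<Omega> \<in> borel_measurable (restrict_space borel \<Omega>)"
    by (rule exit_time_measurable)
  have [measurable]: "(\<lambda>x. x) \<in> restrict_space borel \<Omega> \<rightarrow>\<^sub>M borel"
    by (rule measurable_restrict_space1) simp
  have "(\<lambda>x. x + exit_time \<theta> \<Omega> x *\<^sub>R \<theta>) \<in> borel_measurable (restrict_space borel \<Omega>)"
    by measurable
  moreover have "id \<in> lebesgue_on \<Omega> \<rightarrow>\<^sub>M restrict_space borel \<Omega>"
    by (rule measurable_restrict_space3) (auto simp: measurable_completion)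
  ultimately have "(\<lambda>x. x + exit_time \<theta> \<Omega> x *\<^sub>R \<theta>) \<circ> id \<in> borel_measurable (lebesgue_on \<Omega>)"
    by (rule measurable_comp[rotated])
  then show "exit_point \<theta> \<Omega> \<in> borel_measurable (lebesgue_on \<Omega>)"
    by (simp add: exit_point_def[abs_def] comp_def)
qed

lemma emeasure_dir_measure:
  assumes "A \<in> sets borel" "A \<subseteq> frontier \<Omega>"
  shows "emeasure (dir_measure \<theta> \<Omega>) A =
           (\<integral>\<^sup>+x. indicator A (exit_point \<theta> \<Omega> x) \<partial>lebesgue_on \<Omega>)"
proof -
  have A: "A \<in> sets (restrict_space borel (frontier \<Omega>))"
    using assms unfolding sets_restrict_space by (metis Int_absorb1 imageI)
  have m: "exit_point \<theta> \<Omega> -` A \<inter> space (lebesgue_on \<Omega>) \<in> sets (lebesgue_on \<Omega>)"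
    by (rule measurable_sets[OF exit_point_measurable A])
  have "(\<integral>\<^sup>+x. indicator A (exit_point \<theta> \<Omega> x) \<partial>lebesgue_on \<Omega>) =
        (\<integral>\<^sup>+x. indicator (exit_point \<theta> \<Omega> -` A \<inter> space (lebesgue_on \<Omega>)) x \<partial>lebesgue_on \<Omega>)"
    by (intro nn_integral_cong) (auto simp: indicator_def)
  then show ?thesis
    unfolding dir_measure_def emeasure_distr[OF exit_point_measurable A]
    by (simp only: nn_integral_indicator[OF m])
qed

end


section \<open>Equality almost everywhere\<close>

definition ae_equal :: "'a measure \<Rightarrow> (('a \<Rightarrow> real) \<times> ('a \<Rightarrow> real)) set" where
  "ae_equal M = {(f, g). AE z in M. f z = g z}"

end

theory Submission
  imports Defs
begin

text \<open>Write \<open>x = s *\<^sub>R \<theta> + y\<close> with \<open>y\<close> in the hyperplane orthogonal to \<open>\<theta>\<close>. On a component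
  \<open>{\<alpha><..<\<beta>}\<close> of the slice over \<open>y\<close> the exit point is constantly \<open>\<beta> *\<^sub>R \<theta> + y\<close>, and such a component
  has positive length. By Fubini, a property of boundary points therefore holds almost everywhere for
  the directional measure if and only if, for almost every \<open>y\<close>, it holds at the exit end of
  \<^emph>\<open>every\<close> component of the slice over \<open>y\<close> (\<open>AE_dir_measure_iff\<close>). But the
  defining property of a directional trace also speaks of all exit ends over almost every \<open>y\<close>, so
  changing a trace on a null set gives a trace (\<open>dir_trace_AE_cong\<close>).

  Conversely, the value of a trace at an exit end is forced: a function that agrees almost everywhere
  with one continuous up to \<open>\<beta>\<close> has averages over \<open>{\<beta> - 1/n<..<\<beta>}\<close> tending to the boundary value. Fix
  a Borel representative \<open>v\<close> of \<open>u\<close>, and let \<open>h z\<close> be the limit of the averages of \<open>v\<close> over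
  the segments of length \<open>1/n\<close> that end at \<open>z\<close> and have direction \<open>\<theta>\<close>. By Fubini and
  \<open>AE_dir_measure_iff\<close>, every trace of \<open>u\<close> equals \<open>h\<close> almost everywhere
  (\<open>dir_trace_AE_eq_backward_limit\<close>). This \<open>h\<close> depends on neither the trace nor the
  representative chosen in the definition of the trace, and it is Borel, being a limit of parametric
  integrals. So the one function \<open>h\<close> gives both uniqueness of the trace and a measurable element of its
  class.\<close>

section \<open>Lebesgue measure in coordinates adapted to a direction\<close>

lemma distr_lborel_coordinates:
  fixes \<sigma> :: "'a::euclidean_space \<Rightarrow> 'i"
  assumes \<sigma>: "bij_betw \<sigma> Basis C"
  shows "distr (Pi\<^sub>M C (\<lambda>_. lborel)) borel (\<lambda>c. \<Sum>b\<in>Basis. c (\<sigma> b) *\<^sub>R b) = (lborel :: 'a measure)"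
proof (rule lborel_eqI[symmetric])
  interpret product_sigma_finite "\<lambda>_::'i. lborel :: real measure"
    by standard
  have fin: "finite C" using \<sigma> bij_betw_finite finite_Basis by blast
  have mem: "\<sigma> b \<in> C" if "b \<in> Basis" for b using \<sigma> that bij_betwE by blast
  have m: "(\<lambda>c. \<Sum>b\<in>Basis. c (\<sigma> b) *\<^sub>R b) \<in> Pi\<^sub>M C (\<lambda>_. lborel) \<rightarrow>\<^sub>M (borel :: 'a measure)"
    using mem by (intro borel_measurable_sum borel_measurable_scaleR) auto
  fix l u :: 'a assume le: "\<And>b. b \<in> Basis \<Longrightarrow> l \<bullet> b \<le> u \<bullet> b"
  let ?\<tau> = "inv_into Basis \<sigma>"
  have \<tau>\<sigma>: "?\<tau> (\<sigma> b) = b" if "b \<in> Basis" for b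
    using \<sigma> that by (simp add: bij_betw_def)
  have \<tau>: "bij_betw ?\<tau> C Basis" using \<sigma> by (rule bij_betw_inv_into)
  have "(\<lambda>c. \<Sum>b\<in>Basis. c (\<sigma> b) *\<^sub>R b) -` box l u \<inter> space (Pi\<^sub>M C (\<lambda>_. lborel))
      = Pi\<^sub>E C (\<lambda>i. {l \<bullet> ?\<tau> i <..< u \<bullet> ?\<tau> i})" (is "?L = ?R")
  proof (intro set_eqI)
    fix c
    have C: "C = \<sigma> ` Basis" using \<sigma> by (simp add: bij_betw_def)
    show "c \<in> ?L \<longleftrightarrow> c \<in> ?R"
      by (auto simp: space_PiM box_def inner_sum_left inner_Basis if_distrib cong: if_cong)
        (auto simp: C \<tau>\<sigma> PiE_iff)
  qed
  then have "emeasure (distr (Pi\<^sub>M C (\<lambda>_. lborel)) borel (\<lambda>c. \<Sum>b\<in>Basis. c (\<sigma> b) *\<^sub>R b)) (box l u)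
      = emeasure (Pi\<^sub>M C (\<lambda>_. lborel)) (Pi\<^sub>E C (\<lambda>i. {l \<bullet> ?\<tau> i <..< u \<bullet> ?\<tau> i}))"
    by (subst emeasure_distr[OF m]) auto
  also have "\<dots> = (\<Prod>i\<in>C. emeasure lborel {l \<bullet> ?\<tau> i <..< u \<bullet> ?\<tau> i})"
    by (rule emeasure_PiM[OF fin]) auto
  also have "\<dots> = (\<Prod>b\<in>Basis. emeasure lborel {l \<bullet> b <..< u \<bullet> b})"
    using \<tau> by (rule prod.reindex_bij_betw)
  also have "\<dots> = (\<Prod>b\<in>Basis. ennreal ((u - l) \<bullet> b))"
    using le by (intro prod.cong) (auto simp: inner_diff_left)
  also have "\<dots> = ennreal (\<Prod>b\<in>Basis. (u - l) \<bullet> b)"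
    using le by (intro prod_ennreal) (auto simp: inner_diff_left)
  finally show "emeasure (distr (Pi\<^sub>M C (\<lambda>_. lborel)) borel (\<lambda>c. \<Sum>b\<in>Basis. c (\<sigma> b) *\<^sub>R b)) (box l u)
      = (\<Prod>b\<in>Basis. (u - l) \<bullet> b)" by simp
qed simp

lemma AE_lborel_iff_negligible:
  "(AE x in lborel. P x) \<longleftrightarrow> negligible {x. \<not> P x}"
  using completion.AE_iff_null_sets[where M = lborel and P = P]
  by (simp add: AE_completion_iff negligible_iff_null_sets)

text \<open>The linear map that sends the standard basis to \<open>C\<close> turns coordinates along \<open>Basis\<close> into
  coordinates along \<open>C\<close>, and invertible linear maps preserve negligible sets.\<close>

lemma AE_lborel_orthonormal_basis_iff:
  fixes C :: "'a::euclidean_space set"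
  assumes C: "is_onb C UNIV" and P: "{x. P x} \<in> sets borel"
  shows "(AE x in lborel. P x) \<longleftrightarrow> (AE c in Pi\<^sub>M C (\<lambda>_. lborel). P (\<Sum>b\<in>C. c b *\<^sub>R b))"
proof -
  have orth: "pairwise orthogonal C" and unit: "\<And>b. b \<in> C \<Longrightarrow> norm b = 1" and sp: "span C = UNIV"
    using C by (auto simp: is_onb_def)
  have ind: "independent C"
    using orth unit by (intro pairwise_orthogonal_independent) force+
  have fin: "finite C" using ind by (rule independent_imp_finite)
  have "card C = DIM('a)"
    using dim_eq_card_independent[OF ind] dim_span[of C] sp dim_UNIV by metis
  then obtain \<sigma> where \<sigma>: "bij_betw \<sigma> (Basis :: 'a set) C"
    using fin finite_same_card_bij by (metis finite_Basis)
  have \<sigma>_inner: "\<sigma> a \<bullet> \<sigma> b = (if a = b then 1 else 0)" if "a \<in> Basis" "b \<in> Basis" for a b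
  proof (cases "a = b")
    case True
    then show ?thesis using that bij_betwE[OF \<sigma>] unit by (simp add: dot_square_norm)
  next
    case False
    then have "\<sigma> a \<noteq> \<sigma> b" using that \<sigma> by (auto simp: bij_betw_def inj_on_def)
    then show ?thesis
      using that bij_betwE[OF \<sigma>] orth False by (simp add: pairwise_def orthogonal_def)
  qed
  (* T sends the standard basis to C; R is its transpose, hence its inverse. *)
  define T where "T x = (\<Sum>b\<in>Basis. (x \<bullet> b) *\<^sub>R \<sigma> b)" for x :: 'a
  define R where "R z = (\<Sum>b\<in>Basis. (z \<bullet> \<sigma> b) *\<^sub>R b)" for z :: 'a
  have linT: "linear T" and linR: "linear R"
    by (auto intro!: linearI simp: T_def R_def inner_add_left scaleR_add_left sum.distrib scaleR_sum_right)
  have RT: "R (T x) = x" for x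
  proof -
    have "T x \<bullet> \<sigma> b = x \<bullet> b" if "b \<in> Basis" for b
      using that by (simp add: T_def inner_sum_left \<sigma>_inner if_distrib cong: if_cong)
    then show ?thesis by (simp add: R_def euclidean_representation)
  qed
  then have TR: "T (R z) = z" for z
    using linear_inverse_left[OF linT linR] by (auto simp: fun_eq_iff)
  let ?S = "{x. \<not> P x}"
  have meas: "Collect (\<lambda>x. P (T x)) \<in> sets borel"
  proof -
    have "T \<in> borel_measurable borel"
      unfolding T_def by measurable
    from measurable_sets[OF this P] show ?thesis by (simp add: vimage_def)
  qed
  have "T -` ?S = R ` ?S" "?S = T ` (T -` ?S)"
    using RT TR by (auto simp: image_iff) metis+
  then have "negligible ?S \<longleftrightarrow> negligible (T -` ?S)"
    using negligible_differentiable_image_negligible[of ?S R]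
      negligible_differentiable_image_negligible[of "T -` ?S" T]
      bounded_linear_imp_differentiable_on linR linT
    by (metis order_refl linear_linear)
  then have "(AE x in lborel. P x) \<longleftrightarrow> (AE x in lborel. P (T x))"
    by (simp add: AE_lborel_iff_negligible vimage_def)
  also have "\<dots> \<longleftrightarrow> (AE c in Pi\<^sub>M C (\<lambda>_. lborel). P (T (\<Sum>b\<in>Basis. c (\<sigma> b) *\<^sub>R b)))"
  proof (subst distr_lborel_coordinates[OF \<sigma>, symmetric], rule AE_distr_iff)
    show "(\<lambda>c. \<Sum>b\<in>Basis. c (\<sigma> b) *\<^sub>R b) \<in> Pi\<^sub>M C (\<lambda>_. lborel) \<rightarrow>\<^sub>M (borel :: 'a measure)"
      using bij_betwE[OF \<sigma>] by (intro borel_measurable_sum borel_measurable_scaleR) auto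
  qed (use meas in simp)
  also have "(\<lambda>c. T (\<Sum>b\<in>Basis. c (\<sigma> b) *\<^sub>R b)) = (\<lambda>c. \<Sum>b\<in>C. c b *\<^sub>R b)"
  proof
    fix c
    have "T (\<Sum>b\<in>Basis. c (\<sigma> b) *\<^sub>R b) = (\<Sum>b\<in>Basis. c (\<sigma> b) *\<^sub>R \<sigma> b)"
      by (simp add: T_def inner_sum_left inner_Basis if_distrib cong: if_cong)
    also have "\<dots> = (\<Sum>b\<in>C. c b *\<^sub>R b)" by (rule sum.reindex_bij_betw[OF \<sigma>])
    finally show "T (\<Sum>b\<in>Basis. c (\<sigma> b) *\<^sub>R b) = (\<Sum>b\<in>C. c b *\<^sub>R b)" .
  qed
  finally show ?thesis by (simp add: fun_eq_iff)
qed

lemma is_onb_insert_normal: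
  assumes B: "is_onb B (hyperplane \<theta>)" and nt: "norm \<theta> = 1"
  shows "is_onb (insert \<theta> B) UNIV" "\<theta> \<notin> B" "finite B"
proof -
  have sub: "B \<subseteq> hyperplane \<theta>" and sp: "span B = hyperplane \<theta>"
    and orth: "pairwise orthogonal B" and unit: "\<forall>b\<in>B. norm b = 1"
    using B by (auto simp: is_onb_def)
  have tt: "\<theta> \<bullet> \<theta> = 1" using nt by (simp add: dot_square_norm)
  show "\<theta> \<notin> B" using sub tt by (auto simp: hyperplane_def)
  show "finite B" using orth unit
    by (intro independent_imp_finite pairwise_orthogonal_independent) force+
  have "x \<in> span (insert \<theta> B)" for x
  proof -
    have "x - (x \<bullet> \<theta>) *\<^sub>R \<theta> \<in> span B"
      unfolding sp by (simp add: hyperplane_def inner_diff_left tt)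
    then show ?thesis by (auto simp: span_insert)
  qed
  moreover have "pairwise orthogonal (insert \<theta> B)"
    using orth sub by (auto simp: pairwise_insert orthogonal_def hyperplane_def inner_commute)
  ultimately show "is_onb (insert \<theta> B) UNIV"
    using unit nt by (auto simp: is_onb_def)
qed

lemma space_hyperplane_measure [simp]: "space (hyperplane_measure \<theta>) = hyperplane \<theta>"
  by (simp add: hyperplane_measure_def Let_def space_restrict_space)

lemma sets_hyperplane_measure:
  "sets (hyperplane_measure \<theta>) = sets (restrict_space borel (hyperplane \<theta>))"
  by (simp add: hyperplane_measure_def Let_def)

text \<open>Fubini's theorem for the splitting of the space into the line along \<open>\<theta>\<close> and its orthogonal
  hyperplane: add \<open>\<theta>\<close> to the orthonormal basis underlying \<open>hyperplane_measure\<close>, and integrate the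
  indicator of the exceptional set first over the coordinate along \<open>\<theta>\<close>.\<close>

lemma AE_lborel_slice_iff:
  fixes \<theta> :: "'a::euclidean_space"
  assumes nt: "norm \<theta> = 1" and P: "{x. P x} \<in> sets borel"
  shows "(AE x in lborel. P x) \<longleftrightarrow>
    (AE y in hyperplane_measure \<theta>. AE s in lborel. P (s *\<^sub>R \<theta> + y))"
proof -
  define B where "B = (SOME B. is_onb B (hyperplane \<theta>))"
  have B: "is_onb B (hyperplane \<theta>)"
    unfolding B_def by (rule someI_ex[OF ex_onb_hyperplane])
  note onb = is_onb_insert_normal[OF B nt]
  have HM: "hyperplane_measure \<theta> = distr (Pi\<^sub>M B (\<lambda>_. lborel)) (restrict_space borel (hyperplane \<theta>))
      (\<lambda>c. \<Sum>b\<in>B. c b *\<^sub>R b)"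
    unfolding hyperplane_measure_def B_def[symmetric] by (simp add: Let_def)
  have sumH: "(\<Sum>b\<in>B. c b *\<^sub>R b) \<in> hyperplane \<theta>" for c
  proof -
    have "(\<Sum>b\<in>B. c b *\<^sub>R b) \<in> span B"
      by (intro span_sum span_scale span_base)
    then show ?thesis using B by (simp add: is_onb_def)
  qed
  have mB: "(\<lambda>c. \<Sum>b\<in>B. c b *\<^sub>R b) \<in> Pi\<^sub>M B (\<lambda>_. lborel) \<rightarrow>\<^sub>M borel"
    by (intro borel_measurable_sum borel_measurable_scaleR) auto
  have mB': "(\<lambda>c. \<Sum>b\<in>B. c b *\<^sub>R b) \<in> Pi\<^sub>M B (\<lambda>_. lborel) \<rightarrow>\<^sub>M restrict_space borel (hyperplane \<theta>)"
    using mB sumH by (intro measurable_restrict_space2) auto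
  have mC: "(\<lambda>c. \<Sum>b\<in>insert \<theta> B. c b *\<^sub>R b) \<in> Pi\<^sub>M (insert \<theta> B) (\<lambda>_. lborel) \<rightarrow>\<^sub>M borel"
    by (intro borel_measurable_sum borel_measurable_scaleR) auto
  interpret product_sigma_finite "\<lambda>_::'a. lborel :: real measure"
    by standard
  define f :: "'a \<Rightarrow> ennreal" where "f = indicator {x. \<not> P x}"
  have "{x. \<not> P x} = UNIV - {x. P x}" by auto
  then have f[measurable]: "f \<in> borel_measurable borel" unfolding f_def using P by simp
  have f0: "f x = 0 \<longleftrightarrow> P x" for x by (simp add: f_def indicator_def)
  let ?\<Psi> = "\<lambda>c. \<Sum>b\<in>insert \<theta> B. c b *\<^sub>R b"
  have fC: "(\<lambda>c. f (?\<Psi> c)) \<in> borel_measurable (Pi\<^sub>M (insert \<theta> B) (\<lambda>_. lborel))"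
    using measurable_compose[OF mC f] .
  let ?F = "\<lambda>y. \<integral>\<^sup>+s. f (s *\<^sub>R \<theta> + y) \<partial>lborel"
  have F: "?F \<in> borel_measurable borel" by measurable
  have upd: "?\<Psi> (x(\<theta> := s)) = s *\<^sub>R \<theta> + (\<Sum>b\<in>B. x b *\<^sub>R b)" for x s
  proof -
    have "(\<Sum>b\<in>B. (x(\<theta> := s)) b *\<^sub>R b) = (\<Sum>b\<in>B. x b *\<^sub>R b)"
      using onb(2) by (intro sum.cong) auto
    then show ?thesis using onb by simp
  qed
  have "(AE x in lborel. P x) \<longleftrightarrow> (AE c in Pi\<^sub>M (insert \<theta> B) (\<lambda>_. lborel). f (?\<Psi> c) = 0)"
    unfolding f0 by (rule AE_lborel_orthonormal_basis_iff[OF onb(1) P])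
  also have "\<dots> \<longleftrightarrow> (\<integral>\<^sup>+c. f (?\<Psi> c) \<partial>Pi\<^sub>M (insert \<theta> B) (\<lambda>_. lborel)) = 0"
    by (rule nn_integral_0_iff_AE[OF fC, symmetric])
  also have "(\<integral>\<^sup>+c. f (?\<Psi> c) \<partial>Pi\<^sub>M (insert \<theta> B) (\<lambda>_. lborel))
      = (\<integral>\<^sup>+x. (\<integral>\<^sup>+s. f (?\<Psi> (x(\<theta> := s))) \<partial>lborel) \<partial>Pi\<^sub>M B (\<lambda>_. lborel))"
    by (rule product_nn_integral_insert[OF onb(3,2) fC])
  also have "\<dots> = (\<integral>\<^sup>+x. ?F (\<Sum>b\<in>B. x b *\<^sub>R b) \<partial>Pi\<^sub>M B (\<lambda>_. lborel))"
    unfolding upd ..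
  also have "\<dots> = (\<integral>\<^sup>+y. ?F y \<partial>hyperplane_measure \<theta>)"
    unfolding HM using F by (intro nn_integral_distr[OF mB', symmetric]) (simp add: measurable_restrict_space1)
  also have "\<dots> = 0 \<longleftrightarrow> (AE y in hyperplane_measure \<theta>. ?F y = 0)"
    using F by (intro nn_integral_0_iff_AE)
      (simp add: measurable_restrict_space1 cong: measurable_cong_sets[OF sets_hyperplane_measure refl])
  also have "(\<lambda>y. ?F y = 0) = (\<lambda>y. AE s in lborel. P (s *\<^sub>R \<theta> + y))"
    unfolding f0[symmetric] by (intro ext nn_integral_0_iff_AE) measurable
  finally show ?thesis .
qed

text \<open>One direction survives for arbitrary predicates, because the exceptional set lies in a
  Borel null set.\<close>

lemma AE_lborel_imp_slices:
  fixes \<theta> :: "'a::euclidean_space"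
  assumes nt: "norm \<theta> = 1" and P: "AE x in lborel. P x"
  shows "AE y in hyperplane_measure \<theta>. AE s in lborel. P (s *\<^sub>R \<theta> + y)"
proof -
  from P obtain N where N: "N \<in> null_sets lborel" "{x. \<not> P x} \<subseteq> N"
    by (auto elim: AE_E simp: null_sets_def)
  then have "AE x in lborel. x \<notin> N" by (intro AE_not_in) simp
  moreover have "{x. x \<notin> N} \<in> sets borel"
    using N by (simp add: null_sets_def Collect_neg_eq borel_comp)
  ultimately have "AE y in hyperplane_measure \<theta>. AE s in lborel. s *\<^sub>R \<theta> + y \<notin> N"
    using AE_lborel_slice_iff[OF nt] by blast
  then show ?thesis using N(2) by (auto elim!: eventually_mono)
qed


section \<open>Exit points and components of slices\<close>

context
  fixes \<Omega> :: "'a::euclidean_space set" and \<theta> :: 'a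
  assumes op: "open \<Omega>" and bd: "bounded \<Omega>" and nt: "norm \<theta> = 1"
begin

lemma normal_inner_self: "\<theta> \<bullet> \<theta> = 1"
  using nt by (simp add: dot_square_norm)

lemma proj_in_hyperplane: "proj \<theta> x \<in> hyperplane \<theta>"
  by (simp add: proj_def hyperplane_def inner_diff_left normal_inner_self)

lemma proj_along [simp]: "y \<in> hyperplane \<theta> \<Longrightarrow> proj \<theta> (s *\<^sub>R \<theta> + y) = y"
  by (simp add: proj_def hyperplane_def inner_add_left normal_inner_self)

lemma inner_along: "y \<in> hyperplane \<theta> \<Longrightarrow> (s *\<^sub>R \<theta> + y) \<bullet> \<theta> = s"
  by (simp add: hyperplane_def inner_add_left normal_inner_self)

lemma along_proj: "(x \<bullet> \<theta>) *\<^sub>R \<theta> + proj \<theta> x = x"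
  by (simp add: proj_def)

lemma slice_component_end_notin:
  assumes C: "{\<alpha><..<\<beta>} \<in> components (slice \<theta> \<Omega> y)"
  shows "\<alpha> < \<beta>" "\<beta> \<notin> slice \<theta> \<Omega> y"
proof -
  show ab: "\<alpha> < \<beta>" using in_components_nonempty[OF C] by auto
  show "\<beta> \<notin> slice \<theta> \<Omega> y"
  proof
    assume "\<beta> \<in> slice \<theta> \<Omega> y"
    moreover have "{\<alpha><..<\<beta>} \<subseteq> slice \<theta> \<Omega> y" using C by (rule in_components_subset)
    moreover have eq: "{\<alpha><..\<beta>} = insert \<beta> {\<alpha><..<\<beta>}" using ab by auto
    ultimately have "{\<alpha><..\<beta>} \<subseteq> slice \<theta> \<Omega> y" by simp
    moreover have "{\<alpha><..<\<beta>} \<inter> {\<alpha><..\<beta>} \<noteq> {}" using eq dense[OF ab] by auto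
    ultimately have "{\<alpha><..\<beta>} \<subseteq> {\<alpha><..<\<beta>}"
      using components_maximal[OF C connected_Ioc] by blast
    then show False using ab by auto
  qed
qed

text \<open>Moving from \<open>s *\<^sub>R \<theta> + y\<close> along \<open>\<theta>\<close>, one stays in the component until \<open>\<beta>\<close>, and \<open>\<beta>\<close>
  itself is outside the slice.\<close>

lemma exit_point_on_component:
  assumes C: "{\<alpha><..<\<beta>} \<in> components (slice \<theta> \<Omega> y)" and s: "s \<in> {\<alpha><..<\<beta>}"
  shows "exit_point \<theta> \<Omega> (s *\<^sub>R \<theta> + y) = \<beta> *\<^sub>R \<theta> + y"
proof -
  let ?x = "s *\<^sub>R \<theta> + y"
  have sub: "{\<alpha><..<\<beta>} \<subseteq> slice \<theta> \<Omega> y" using C by (rule in_components_subset)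
  then have x: "?x \<in> \<Omega>" using s by (auto simp: slice_def)
  have shift: "?x + t *\<^sub>R \<theta> = (s + t) *\<^sub>R \<theta> + y" for t by (simp add: scaleR_add_left)
  have less: "a < exit_time \<theta> \<Omega> ?x \<longleftrightarrow> a < \<beta> - s" if a: "0 \<le> a" for a
  proof -
    have "a < exit_time \<theta> \<Omega> ?x \<longleftrightarrow> (\<forall>t\<in>{0..a}. s + t \<in> slice \<theta> \<Omega> y)"
      unfolding less_exit_time_iff[OF op bd nt x a] shift slice_def by simp
    also have "\<dots> \<longleftrightarrow> a < \<beta> - s"
    proof
      assume "a < \<beta> - s"
      then show "\<forall>t\<in>{0..a}. s + t \<in> slice \<theta> \<Omega> y" using s sub by auto
    next
      assume all: "\<forall>t\<in>{0..a}. s + t \<in> slice \<theta> \<Omega> y"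
      show "a < \<beta> - s"
      proof (rule ccontr)
        assume "\<not> a < \<beta> - s"
        then have "\<beta> - s \<in> {0..a}" using s by auto
        then have "s + (\<beta> - s) \<in> slice \<theta> \<Omega> y" using all by blast
        then show False using slice_component_end_notin(2)[OF C] by simp
      qed
    qed
    finally show ?thesis .
  qed
  have "exit_time \<theta> \<Omega> ?x = \<beta> - s"
    using less[of "exit_time \<theta> \<Omega> ?x"] less[of "\<beta> - s"] exit_time_pos[OF op bd nt x] s by force
  then show ?thesis unfolding exit_point_def by (simp add: shift)
qed

text \<open>The component of the slice containing the coordinate of \<open>x\<close> is connected, open and bounded, so
  it is the open interval between its infimum and its supremum.\<close>

lemma slice_component_through:
  assumes x: "x \<in> \<Omega>"
  obtains \<alpha> \<beta> where "{\<alpha><..<\<beta>} \<in> components (slice \<theta> \<Omega> (proj \<theta> x))" "x \<bullet> \<theta> \<in> {\<alpha><..<\<beta>}"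
    "exit_point \<theta> \<Omega> x = \<beta> *\<^sub>R \<theta> + proj \<theta> x"
proof -
  let ?y = "proj \<theta> x"
  let ?C = "connected_component_set (slice \<theta> \<Omega> ?y) (x \<bullet> \<theta>)"
  have xs: "x \<bullet> \<theta> \<in> slice \<theta> \<Omega> ?y" using x by (simp add: slice_def along_proj)
  then have C: "?C \<in> components (slice \<theta> \<Omega> ?y)" by (rule componentsI)
  have xC: "x \<bullet> \<theta> \<in> ?C" using xs by simp
  have "slice \<theta> \<Omega> ?y = (\<lambda>s. s *\<^sub>R \<theta> + ?y) -` \<Omega>" by (auto simp: slice_def)
  then have "open (slice \<theta> \<Omega> ?y)"
    using op by (auto intro!: open_vimage continuous_intros)
  then have opC: "open ?C" using C open_components by blast
  obtain M where M: "\<And>z. z \<in> \<Omega> \<Longrightarrow> norm z \<le> M"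
    using bd unfolding bounded_iff by blast
  have bdd: "\<bar>s\<bar> \<le> M" if "s \<in> ?C" for s
  proof -
    have "s *\<^sub>R \<theta> + ?y \<in> \<Omega>"
      using that connected_component_subset by (force simp: slice_def)
    then have "norm (s *\<^sub>R \<theta> + ?y) \<le> M" by (rule M)
    moreover have "\<bar>s\<bar> \<le> norm (s *\<^sub>R \<theta> + ?y)"
      using Cauchy_Schwarz_ineq2[of "s *\<^sub>R \<theta> + ?y" \<theta>] nt
      by (simp add: inner_along proj_in_hyperplane)
    ultimately show ?thesis by simp
  qed
  then have bd: "bdd_below ?C" "bdd_above ?C"
    by (meson abs_le_D1 bdd_aboveI abs_le_D2 bdd_belowI minus_le_iff)+
  define \<alpha> \<beta> where "\<alpha> = Inf ?C" "\<beta> = Sup ?C"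
  have "?C = {\<alpha><..<\<beta>}"
  proof (intro equalityI subsetI)
    fix s assume s: "s \<in> ?C"
    then obtain e where e: "e > 0" "ball s e \<subseteq> ?C" using opC by (auto elim: openE)
    then have "s - e / 2 \<in> ?C" "s + e / 2 \<in> ?C"
      by (auto simp: subset_eq dist_real_def)
    then have "\<alpha> \<le> s - e / 2" "s + e / 2 \<le> \<beta>"
      unfolding \<alpha>_\<beta>_def using bd by (auto intro: cInf_lower cSup_upper)
    then show "s \<in> {\<alpha><..<\<beta>}" using e(1) by auto
  next
    fix s assume s: "s \<in> {\<alpha><..<\<beta>}"
    obtain a where "a \<in> ?C" "a < s"
      using s bd xC cInf_less_iff[of ?C s] unfolding \<alpha>_\<beta>_def greaterThanLessThan_iff by blast
    moreover obtain b where "b \<in> ?C" "s < b"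
      using s bd xC less_cSup_iff[of ?C s] unfolding \<alpha>_\<beta>_def greaterThanLessThan_iff by blast
    ultimately show "s \<in> ?C"
      using connectedD_interval[OF connected_connected_component, of a _ _ b s] by (meson less_imp_le)
  qed
  then show thesis
    using that[of \<alpha> \<beta>] C xC exit_point_on_component[of \<alpha> \<beta> ?y "x \<bullet> \<theta>"] by (simp add: along_proj)
qed

text \<open>A measurable image of an open set need not be Borel in general. This one is, since \<open>z\<close> is an exit
  point if and only if \<open>z\<close> is outside \<open>\<Omega>\<close> and, for some \<open>n\<close>, the points \<open>z - t *\<^sub>R \<theta>\<close> with
  \<open>0 < t \<le> 1/n\<close> all lie in \<open>\<Omega>\<close>. As \<open>\<Omega>\<close> is open, the same condition over a compact range of \<open>t\<close>
  defines an open set, and the half-open range is a countable union of compact ones.\<close>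

lemma exit_points_borel: "exit_point \<theta> \<Omega> ` \<Omega> \<in> sets borel"
proof -
  define U where "U a b = {z. \<forall>t\<in>{a..b}. z - t *\<^sub>R \<theta> \<in> \<Omega>}" for a b
  have "open (U a b)" for a b
  proof -
    let ?K = "(\<lambda>t. t *\<^sub>R \<theta>) ` {a..b}"
    have "compact ?K" by (intro compact_continuous_image continuous_intros) auto
    then have "closed (\<Union>z\<in>-\<Omega>. \<Union>k\<in>?K. {z + k})"
      using op by (intro closed_compact_sums) auto
    moreover have "U a b = - (\<Union>z\<in>-\<Omega>. \<Union>k\<in>?K. {z + k})"
    proof (intro set_eqI iffI)
      fix z assume "z \<in> U a b"
      then show "z \<in> - (\<Union>z\<in>-\<Omega>. \<Union>k\<in>?K. {z + k})" by (auto simp: U_def)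
    next
      fix z assume z: "z \<in> - (\<Union>z\<in>-\<Omega>. \<Union>k\<in>?K. {z + k})"
      show "z \<in> U a b" unfolding U_def
      proof (intro CollectI ballI, rule ccontr)
        fix t assume t: "t \<in> {a..b}" "z - t *\<^sub>R \<theta> \<notin> \<Omega>"
        have "z = (z - t *\<^sub>R \<theta>) + t *\<^sub>R \<theta>" by simp
        then show False using z t by blast
      qed
    qed
    ultimately show ?thesis by (simp add: open_closed)
  qed
  then have "(\<Union>n. \<Inter>m. U (1 / real (Suc m)) (1 / real (Suc n))) - \<Omega> \<in> sets borel"
    using op by (intro sets.Diff sets.countable_UN sets.countable_INT) auto
  moreover have "exit_point \<theta> \<Omega> ` \<Omega> = (\<Union>n. \<Inter>m. U (1 / real (Suc m)) (1 / real (Suc n))) - \<Omega>"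
  proof (intro equalityI subsetI)
    fix z assume "z \<in> exit_point \<theta> \<Omega> ` \<Omega>"
    then obtain x where x: "x \<in> \<Omega>" and z: "z = exit_point \<theta> \<Omega> x" by auto
    obtain \<alpha> \<beta> where C: "{\<alpha><..<\<beta>} \<in> components (slice \<theta> \<Omega> (proj \<theta> x))"
      and z': "z = \<beta> *\<^sub>R \<theta> + proj \<theta> x"
      using slice_component_through[OF x] z by metis
    obtain n where n: "1 / real (Suc n) < \<beta> - \<alpha>"
      using slice_component_end_notin(1)[OF C] nat_approx_posE[of "\<beta> - \<alpha>"] by auto
    have "z \<in> U (1 / real (Suc m)) (1 / real (Suc n))" for m
      unfolding U_def
    proof (intro CollectI ballI)
      fix t assume "t \<in> {1 / real (Suc m)..1 / real (Suc n)}"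
      then have "0 < t" "t < \<beta> - \<alpha>" using n
        by (auto intro: less_le_trans[of 0 "1 / real (Suc m)"] simp del: of_nat_Suc)
      then have "\<beta> - t \<in> slice \<theta> \<Omega> (proj \<theta> x)" using in_components_subset[OF C] by auto
      then show "z - t *\<^sub>R \<theta> \<in> \<Omega>" by (simp add: slice_def z' algebra_simps)
    qed
    moreover have "z \<notin> \<Omega>"
      using slice_component_end_notin(2)[OF C] by (simp add: slice_def z')
    ultimately show "z \<in> (\<Union>n. \<Inter>m. U (1 / real (Suc m)) (1 / real (Suc n))) - \<Omega>" by blast
  next
    fix z assume "z \<in> (\<Union>n. \<Inter>m. U (1 / real (Suc m)) (1 / real (Suc n))) - \<Omega>"
    then obtain n where n: "\<And>m. z \<in> U (1 / real (Suc m)) (1 / real (Suc n))" and zn: "z \<notin> \<Omega>"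
      by blast
    have inside: "z - t *\<^sub>R \<theta> \<in> \<Omega>" if t: "0 < t" "t \<le> 1 / real (Suc n)" for t
    proof -
      obtain m where "1 / real (Suc m) < t" using nat_approx_posE[OF t(1)] by auto
      then show ?thesis using n[of m] t by (auto simp: U_def)
    qed
    (* Step back by 1 / Suc n: the point reached lies in \<Omega> and exits exactly at z. *)
    define e where "e = 1 / real (Suc n)"
    have e: "0 < e" by (simp add: e_def)
    define x where "x = z - e *\<^sub>R \<theta>"
    have x: "x \<in> \<Omega>" using inside e by (simp add: x_def e_def)
    have step: "x + t *\<^sub>R \<theta> = z - (e - t) *\<^sub>R \<theta>" for t by (simp add: x_def algebra_simps)
    have less: "a < exit_time \<theta> \<Omega> x \<longleftrightarrow> a < e" if a: "0 \<le> a" for a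
      unfolding less_exit_time_iff[OF op bd nt x a] step
    proof
      assume all: "\<forall>t\<in>{0..a}. z - (e - t) *\<^sub>R \<theta> \<in> \<Omega>"
      show "a < e"
      proof (rule ccontr)
        assume "\<not> a < e"
        then have "z - (e - e) *\<^sub>R \<theta> \<in> \<Omega>" using all e by (intro bspec[OF all]) auto
        then show False using zn by simp
      qed
    next
      assume "a < e"
      then show "\<forall>t\<in>{0..a}. z - (e - t) *\<^sub>R \<theta> \<in> \<Omega>"
        using inside by (auto simp: e_def)
    qed
    have "exit_time \<theta> \<Omega> x = e"
      using less[of "exit_time \<theta> \<Omega> x"] less[of e] exit_time_pos[OF op bd nt x] e by force
    then have "exit_point \<theta> \<Omega> x = z" by (simp add: exit_point_def x_def)
    then show "z \<in> exit_point \<theta> \<Omega> ` \<Omega>" using x by blast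
  qed
  ultimately show ?thesis by simp
qed

section \<open>Null sets of the directional measure\<close>

text \<open>From left to right: a component with a bad exit end consists of points that exit badly, and
  it is not negligible, so over almost every \<open>y\<close> there is none. From right to left: the points that
  project into a null set \<open>N\<close> of the hyperplane form a null set of the whole space, and the exit map
  does not change the projection. Since \<open>P\<close> is arbitrary, the bad set must be covered by a Borel set;
  the complement of \<open>?G\<close> below serves. It also contains the boundary points that are not exit points,
  on which the hypothesis gives no information.\<close>

lemma AE_dir_measure_iff:
  "(AE z in dir_measure \<theta> \<Omega>. P z) \<longleftrightarrow>
    (AE y in hyperplane_measure \<theta>. \<forall>\<alpha> \<beta>. {\<alpha><..<\<beta>} \<in> components (slice \<theta> \<Omega> y) \<longrightarrow> P (\<beta> *\<^sub>R \<theta> + y))"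
  (is "?L \<longleftrightarrow> (AE y in _. ?Q y)")
proof
  note exit_m = exit_point_measurable[OF op bd nt]
  have AE_on: "(AE x in lebesgue_on \<Omega>. R x) \<longleftrightarrow> (AE x in lborel. x \<in> \<Omega> \<longrightarrow> R x)" for R
    using op by (subst AE_restrict_space_iff) (auto simp: AE_completion_iff)
  {
    assume ?L
    then have "AE x in lebesgue_on \<Omega>. P (exit_point \<theta> \<Omega> x)"
      unfolding dir_measure_def by (rule AE_distrD[OF exit_m])
    then have "AE y in hyperplane_measure \<theta>. AE s in lborel.
        s *\<^sub>R \<theta> + y \<in> \<Omega> \<longrightarrow> P (exit_point \<theta> \<Omega> (s *\<^sub>R \<theta> + y))"
      unfolding AE_on by (rule AE_lborel_imp_slices[OF nt])
    then show "AE y in hyperplane_measure \<theta>. ?Q y"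
    proof (rule eventually_mono, intro allI impI)
      fix y \<alpha> \<beta>
      assume ae: "AE s in lborel. s *\<^sub>R \<theta> + y \<in> \<Omega> \<longrightarrow> P (exit_point \<theta> \<Omega> (s *\<^sub>R \<theta> + y))"
        and C: "{\<alpha><..<\<beta>} \<in> components (slice \<theta> \<Omega> y)"
      show "P (\<beta> *\<^sub>R \<theta> + y)"
      proof (rule ccontr)
        assume np: "\<not> P (\<beta> *\<^sub>R \<theta> + y)"
        have "AE s in lborel. s \<notin> {\<alpha><..<\<beta>}"
          using ae
        proof (rule eventually_mono, intro notI)
          fix s assume h: "s *\<^sub>R \<theta> + y \<in> \<Omega> \<longrightarrow> P (exit_point \<theta> \<Omega> (s *\<^sub>R \<theta> + y))"
            and s: "s \<in> {\<alpha><..<\<beta>}"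
          then show False using in_components_subset[OF C] exit_point_on_component[OF C s] np
            by (auto simp: slice_def)
        qed
        then have "negligible {\<alpha><..<\<beta>}" unfolding AE_lborel_iff_negligible by (simp del: greaterThanLessThan_iff)
        then show False using open_not_negligible[of "{\<alpha><..<\<beta>}"] slice_component_end_notin(1)[OF C] by auto
      qed
    qed
  next
    assume "AE y in hyperplane_measure \<theta>. ?Q y"
    then obtain N where N: "N \<in> null_sets (hyperplane_measure \<theta>)"
      and Q: "\<And>y. y \<in> space (hyperplane_measure \<theta>) - N \<Longrightarrow> ?Q y"
      by (rule AE_E3) blast
    have "closed (hyperplane \<theta>)"
      unfolding hyperplane_def by (intro closed_subspace subspace_hyperplane2)
    then have Nb: "N \<in> sets borel"
      using N by (auto simp: null_sets_def sets_hyperplane_measure sets_restrict_space)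
    have projm: "proj \<theta> \<in> borel_measurable borel"
      unfolding proj_def[abs_def] by measurable
    let ?G = "exit_point \<theta> \<Omega> ` \<Omega> - proj \<theta> -` N"
    have vN: "proj \<theta> -` N \<in> sets borel" using measurable_sets[OF projm Nb] by simp
    have "AE y in hyperplane_measure \<theta>. AE s in lborel. proj \<theta> (s *\<^sub>R \<theta> + y) \<notin> N"
      using AE_not_in[OF N] by (rule AE_mp) (auto intro!: AE_I2)
    moreover have "{x. proj \<theta> x \<notin> N} \<in> sets borel"
      using vN borel_comp[of "proj \<theta> -` N"] by (simp add: vimage_def Collect_neg_eq)
    ultimately have "AE x in lborel. proj \<theta> x \<notin> N"
      by (simp add: AE_lborel_slice_iff[OF nt])
    moreover have "proj \<theta> (exit_point \<theta> \<Omega> x) = proj \<theta> x" for x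
      by (simp add: exit_point_def proj_def inner_add_left normal_inner_self algebra_simps)
    ultimately have ae: "AE x in lebesgue_on \<Omega>. exit_point \<theta> \<Omega> x \<in> ?G"
      unfolding AE_on by (auto elim: eventually_mono)
    have "?G \<in> sets borel" using exit_points_borel vN by auto
    moreover have "?G \<subseteq> frontier \<Omega>" using exit_point_in_frontier[OF op bd nt] by auto
    ultimately have "?G \<in> sets (restrict_space borel (frontier \<Omega>))"
      unfolding sets_restrict_space by (metis Int_absorb1 imageI)
    moreover have "{z \<in> space (restrict_space borel (frontier \<Omega>)). z \<in> ?G} = ?G"
      using \<open>?G \<subseteq> frontier \<Omega>\<close> by (auto simp: space_restrict_space)
    ultimately have "AE z in dir_measure \<theta> \<Omega>. z \<in> ?G"
      unfolding dir_measure_def using ae by (subst AE_distr_iff[OF exit_m]) simp_all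
    then show ?L
    proof (rule eventually_mono)
      fix z assume z: "z \<in> ?G"
      then obtain x where x: "x \<in> \<Omega>" and zx: "z = exit_point \<theta> \<Omega> x" by auto
      obtain \<alpha> \<beta> where C: "{\<alpha><..<\<beta>} \<in> components (slice \<theta> \<Omega> (proj \<theta> x))"
        and z': "z = \<beta> *\<^sub>R \<theta> + proj \<theta> x"
        using slice_component_through[OF x] zx by metis
      have "proj \<theta> x \<in> space (hyperplane_measure \<theta>) - N"
        using z z' proj_in_hyperplane by auto
      from Q[OF this] C z' show "P z" by blast
    qed
  }
qed

end


section \<open>Boundary values as limits of averages\<close>

text \<open>Near \<open>\<beta>\<close>, \<open>f\<close> is almost everywhere within any given distance of \<open>w \<beta>\<close>, so its averages
  are as well. As the averages only see \<open>f\<close>, any two such \<open>w\<close> have the same value at \<open>\<beta>\<close>.\<close>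

lemma tendsto_backward_averages:
  fixes f w :: "real \<Rightarrow> real"
  assumes ab: "\<alpha> < \<beta>" and w: "continuous_on {\<alpha><..\<beta>} w" and f: "f \<in> borel_measurable borel"
    and eq: "AE s in lborel. s \<in> {\<alpha><..<\<beta>} \<longrightarrow> f s = w s"
  shows "(\<lambda>n. real (Suc n) * (\<integral>s. indicator {\<beta> - 1 / real (Suc n)<..<\<beta>} s * f s \<partial>lborel)) \<longlonglongrightarrow> w \<beta>"
proof (rule LIMSEQ_I)
  fix r :: real assume r: "0 < r"
  obtain d where d: "0 < d" "\<And>s. s \<in> {\<alpha><..\<beta>} \<Longrightarrow> \<bar>s - \<beta>\<bar> < d \<Longrightarrow> \<bar>w s - w \<beta>\<bar> < r / 2"
  proof -
    have "\<beta> \<in> {\<alpha><..\<beta>}" "0 < r / 2" using ab r by auto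
    then show thesis using that w[unfolded continuous_on_real_range real_norm_def] by blast
  qed
  obtain k where k: "1 / real (Suc k) < min d (\<beta> - \<alpha>)"
    using nat_approx_posE[of "min d (\<beta> - \<alpha>)"] d ab by auto
  have "norm (real (Suc n) * (\<integral>s. indicator {\<beta> - 1 / real (Suc n)<..<\<beta>} s * f s \<partial>lborel) - w \<beta>) < r"
    if n: "k \<le> n" for n
  proof -
    define e where "e = 1 / real (Suc n)"
    have "e \<le> 1 / real (Suc k)" using n by (simp add: e_def frac_le)
    then have e: "0 < e" "e < d" "e < \<beta> - \<alpha>" using k by (auto simp: e_def)
    let ?I = "{\<beta> - e<..<\<beta>}"
    have near: "AE s in lborel. s \<in> ?I \<longrightarrow> w \<beta> - r / 2 \<le> f s \<and> f s \<le> w \<beta> + r / 2"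
      using eq
    proof (rule eventually_mono, intro impI)
      fix s assume h: "s \<in> {\<alpha><..<\<beta>} \<longrightarrow> f s = w s" and s: "s \<in> ?I"
      then have "\<bar>f s - w \<beta>\<bar> < r / 2" using d(2)[of s] e by auto
      then show "w \<beta> - r / 2 \<le> f s \<and> f s \<le> w \<beta> + r / 2" by linarith
    qed
    have int1: "integrable lborel (\<lambda>s. indicator ?I s * c :: real)" for c
      using e by (intro integrable_mult_left integrable_real_indicator) auto
    have int: "integrable lborel (\<lambda>s. indicator ?I s * f s)"
    proof (rule Bochner_Integration.integrable_bound[OF int1])
      show "(\<lambda>s. indicator ?I s * f s) \<in> borel_measurable lborel" using f by simp
      show "AE s in lborel. norm (indicator ?I s * f s) \<le> norm (indicator ?I s * (\<bar>w \<beta>\<bar> + r / 2))"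
        using near
      proof (rule eventually_mono)
        fix s assume "s \<in> ?I \<longrightarrow> w \<beta> - r / 2 \<le> f s \<and> f s \<le> w \<beta> + r / 2"
        then have "s \<in> ?I \<Longrightarrow> \<bar>f s\<bar> \<le> \<bar>\<bar>w \<beta>\<bar> + r / 2\<bar>" by linarith
        then show "norm (indicator ?I s * f s) \<le> norm (indicator ?I s * (\<bar>w \<beta>\<bar> + r / 2))"
          by (cases "s \<in> ?I") simp_all
      qed
    qed
    have val: "(\<integral>s. indicator ?I s * c \<partial>lborel) = e * c" for c :: real
      using e by simp
    have "(\<integral>s. indicator ?I s * f s \<partial>lborel) \<le> (\<integral>s. indicator ?I s * (w \<beta> + r / 2) \<partial>lborel)"
      using near by (intro integral_mono_AE int int1) (auto elim!: eventually_mono split: split_indicator)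
    moreover have "(\<integral>s. indicator ?I s * (w \<beta> - r / 2) \<partial>lborel) \<le> (\<integral>s. indicator ?I s * f s \<partial>lborel)"
      using near by (intro integral_mono_AE int int1) (auto elim!: eventually_mono split: split_indicator)
    ultimately have "e * (w \<beta> - r / 2) \<le> (\<integral>s. indicator ?I s * f s \<partial>lborel)"
      "(\<integral>s. indicator ?I s * f s \<partial>lborel) \<le> e * (w \<beta> + r / 2)"
      unfolding val by auto
    then have "w \<beta> - r / 2 \<le> (\<integral>s. indicator ?I s * f s \<partial>lborel) / e"
      "(\<integral>s. indicator ?I s * f s \<partial>lborel) / e \<le> w \<beta> + r / 2"
      using e by (auto simp: pos_le_divide_eq pos_divide_le_eq mult.commute)
    moreover have "(\<integral>s. indicator ?I s * f s \<partial>lborel) / e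
        = real (Suc n) * (\<integral>s. indicator ?I s * f s \<partial>lborel)"
      by (simp add: e_def)
    ultimately show ?thesis using r unfolding e_def[symmetric] by (auto simp: abs_less_iff)
  qed
  then show "\<exists>k. \<forall>n\<ge>k. norm (real (Suc n) * (\<integral>s. indicator {\<beta> - 1 / real (Suc n)<..<\<beta>} s * f s \<partial>lborel)
      - w \<beta>) < r" by blast
qed

text \<open>The averages use the values of \<open>v\<close> on the whole space; at an exit point, \<open>z - t *\<^sub>R \<theta>\<close> is in
  \<open>\<Omega>\<close> for all small \<open>t > 0\<close>, so values outside \<open>\<Omega>\<close> do not influence the limit there.\<close>

definition backward_limit :: "'a::euclidean_space \<Rightarrow> ('a \<Rightarrow> real) \<Rightarrow> 'a \<Rightarrow> real" where
  "backward_limit \<theta> v z = lim (\<lambda>n. real (Suc n) *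
     (\<integral>t. indicator {0<..<1 / real (Suc n)} t * v (z - t *\<^sub>R \<theta>) \<partial>lborel))"

lemma backward_limit_measurable:
  assumes [measurable]: "v \<in> borel_measurable borel"
  shows "backward_limit \<theta> v \<in> borel_measurable borel"
proof -
  have "(\<lambda>z. \<integral>t. indicator {0<..<1 / real (Suc n)} t * v (z - t *\<^sub>R \<theta>) \<partial>lborel)
      \<in> borel_measurable borel" for n
    by measurable
  then show ?thesis unfolding backward_limit_def[abs_def] by measurable
qed

section \<open>The class of directional traces\<close>

context
  fixes \<Omega> :: "'a::euclidean_space set" and \<theta> :: 'a
  assumes op: "open \<Omega>" and bd: "bounded \<Omega>" and nt: "norm \<theta> = 1"
begin

text \<open>On almost every slice \<open>v\<close> agrees almost everywhere with the representative \<open>u'\<close> chosen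
  for the trace, hence on each component with a function that is continuous up to the exit end.\<close>

lemma dir_trace_AE_eq_backward_limit:
  assumes g: "is_dir_trace \<theta> \<Omega> u g"
    and v: "v \<in> borel_measurable borel" "AE x in lebesgue_on \<Omega>. v x = u x"
  shows "AE z in dir_measure \<theta> \<Omega>. g z = backward_limit \<theta> v z"
proof -
  from g obtain u' A where u': "AE x in lebesgue_on \<Omega>. u' x = u x"
    and A: "proj \<theta> ` \<Omega> - A \<in> null_sets (completion (hyperplane_measure \<theta>))"
    and end_value: "\<And>y \<alpha> \<beta>. y \<in> A \<Longrightarrow> {\<alpha><..<\<beta>} \<in> components (slice \<theta> \<Omega> y) \<Longrightarrow>
       \<exists>w. continuous_on {\<alpha><..\<beta>} w \<and> (AE s in lebesgue_on {\<alpha><..<\<beta>}. w s = u' (s *\<^sub>R \<theta> + y)) \<and>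
         g (\<beta> *\<^sub>R \<theta> + y) = w \<beta>"
    unfolding is_dir_trace_def by blast
  have "AE x in lborel. x \<in> \<Omega> \<longrightarrow> v x = u' x"
    using v(2) u' op
    by (auto simp: AE_restrict_space_iff AE_completion_iff elim: eventually_elim2)
  then have slices: "AE y in hyperplane_measure \<theta>. AE s in lborel.
      s *\<^sub>R \<theta> + y \<in> \<Omega> \<longrightarrow> v (s *\<^sub>R \<theta> + y) = u' (s *\<^sub>R \<theta> + y)"
    by (rule AE_lborel_imp_slices[OF nt])
  have inA: "AE y in hyperplane_measure \<theta>. y \<notin> proj \<theta> ` \<Omega> - A"
    using AE_not_in[OF A] by (simp only: AE_completion_iff)
  show ?thesis
    unfolding AE_dir_measure_iff[OF op bd nt]
    using slices inA AE_space
  proof (eventually_elim, intro allI impI)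
    fix y \<alpha> \<beta>
    assume vu: "AE s in lborel. s *\<^sub>R \<theta> + y \<in> \<Omega> \<longrightarrow> v (s *\<^sub>R \<theta> + y) = u' (s *\<^sub>R \<theta> + y)"
      and y: "y \<notin> proj \<theta> ` \<Omega> - A" "y \<in> space (hyperplane_measure \<theta>)"
      and C: "{\<alpha><..<\<beta>} \<in> components (slice \<theta> \<Omega> y)"
    have ab: "\<alpha> < \<beta>" by (rule slice_component_end_notin(1)[OF op bd nt C])
    have sub: "s *\<^sub>R \<theta> + y \<in> \<Omega>" if "s \<in> {\<alpha><..<\<beta>}" for s
      using in_components_subset[OF C] that by (auto simp: slice_def)
    obtain s where "s \<in> {\<alpha><..<\<beta>}" using dense[OF ab] by auto
    then have "y \<in> proj \<theta> ` \<Omega>"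
      using sub proj_along[OF op bd nt, of y s] y(2) by (metis image_eqI space_hyperplane_measure)
    then have "y \<in> A" using y by blast
    from end_value[OF this C] obtain w where w: "continuous_on {\<alpha><..\<beta>} w"
      and wu: "AE s in lebesgue_on {\<alpha><..<\<beta>}. w s = u' (s *\<^sub>R \<theta> + y)" and gw: "g (\<beta> *\<^sub>R \<theta> + y) = w \<beta>"
      by blast
    have "AE s in lborel. s \<in> {\<alpha><..<\<beta>} \<longrightarrow> w s = u' (s *\<^sub>R \<theta> + y)"
      using wu by (simp add: AE_restrict_space_iff AE_completion_iff)
    with vu have ae: "AE s in lborel. s \<in> {\<alpha><..<\<beta>} \<longrightarrow> v (s *\<^sub>R \<theta> + y) = w s"
      by eventually_elim (use sub in auto)
    have "(\<lambda>s. v (s *\<^sub>R \<theta> + y)) \<in> borel_measurable borel" using v(1) by measurable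
    from tendsto_backward_averages[OF ab w this ae]
    have lim: "(\<lambda>n. real (Suc n) * (\<integral>s. indicator {\<beta> - 1 / real (Suc n)<..<\<beta>} s * v (s *\<^sub>R \<theta> + y) \<partial>lborel))
      \<longlonglongrightarrow> w \<beta>" .
    (* Substitute s = \<beta> - t. *)
    have "(\<integral>s. indicator {\<beta> - 1 / real (Suc n)<..<\<beta>} s * v (s *\<^sub>R \<theta> + y) \<partial>lborel)
        = (\<integral>t. indicator {0<..<1 / real (Suc n)} t * v (\<beta> *\<^sub>R \<theta> + y - t *\<^sub>R \<theta>) \<partial>lborel)" for n
      by (subst lborel_integral_real_affine[where c = "-1" and t = \<beta>])
        (auto intro!: Bochner_Integration.integral_cong simp: indicator_def algebra_simps)
    with lim show "g (\<beta> *\<^sub>R \<theta> + y) = backward_limit \<theta> v (\<beta> *\<^sub>R \<theta> + y)"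
      unfolding backward_limit_def gw by (simp add: limI)
  qed
qed

text \<open>Keep the representative \<open>u'\<close>, and shrink \<open>A\<close> to the \<open>y\<close> over which \<open>g\<close> and \<open>g'\<close> agree at all
  exit ends.\<close>

lemma dir_trace_AE_cong:
  assumes g: "is_dir_trace \<theta> \<Omega> u g" and eq: "AE z in dir_measure \<theta> \<Omega>. g' z = g z"
  shows "is_dir_trace \<theta> \<Omega> u g'"
proof -
  from g obtain u' A where u': "AE x in lebesgue_on \<Omega>. u' x = u x" and sub: "A \<subseteq> proj \<theta> ` \<Omega>"
    and A: "proj \<theta> ` \<Omega> - A \<in> null_sets (completion (hyperplane_measure \<theta>))"
    and H1: "\<And>y. y \<in> A \<Longrightarrow> (\<lambda>s. u' (s *\<^sub>R \<theta> + y)) \<in> H1 (slice \<theta> \<Omega> y)"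
    and end_value: "\<And>y \<alpha> \<beta>. y \<in> A \<Longrightarrow> {\<alpha><..<\<beta>} \<in> components (slice \<theta> \<Omega> y) \<Longrightarrow>
       \<exists>w. continuous_on {\<alpha><..\<beta>} w \<and> (AE s in lebesgue_on {\<alpha><..<\<beta>}. w s = u' (s *\<^sub>R \<theta> + y)) \<and>
         g (\<beta> *\<^sub>R \<theta> + y) = w \<beta>"
    unfolding is_dir_trace_def by blast
  define Q where "Q y \<longleftrightarrow> (\<forall>\<alpha> \<beta>. {\<alpha><..<\<beta>} \<in> components (slice \<theta> \<Omega> y) \<longrightarrow>
      g' (\<beta> *\<^sub>R \<theta> + y) = g (\<beta> *\<^sub>R \<theta> + y))" for y
  have "AE y in hyperplane_measure \<theta>. Q y"
    using eq unfolding AE_dir_measure_iff[OF op bd nt] Q_def .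
  then have "{y \<in> hyperplane \<theta>. \<not> Q y} \<in> null_sets (completion (hyperplane_measure \<theta>))"
    using completion.AE_iff_null_sets[where M = "hyperplane_measure \<theta>" and P = Q] by (simp add: AE_completion_iff)
  then have "(proj \<theta> ` \<Omega> - A) \<union> {y \<in> hyperplane \<theta>. \<not> Q y} \<in> null_sets (completion (hyperplane_measure \<theta>))"
    using A by (rule null_sets.Un[rotated])
  moreover have "proj \<theta> ` \<Omega> - {y \<in> A. Q y} \<subseteq> (proj \<theta> ` \<Omega> - A) \<union> {y \<in> hyperplane \<theta>. \<not> Q y}"
    using proj_in_hyperplane[OF op bd nt] by auto
  ultimately have "proj \<theta> ` \<Omega> - {y \<in> A. Q y} \<in> null_sets (completion (hyperplane_measure \<theta>))"
    by (metis null_sets_completion_subset)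
  then show ?thesis
    unfolding is_dir_trace_def
    using u' sub H1 end_value by (intro exI[of _ u'] exI[of _ "{y \<in> A. Q y}"]) (auto simp: Q_def)
qed

end

lemma L2_ex_borel_representative:
  assumes u: "u \<in> L2 \<Omega>" and op: "open \<Omega>"
  obtains v where "v \<in> borel_measurable borel" "AE x in lebesgue_on \<Omega>. v x = u x"
proof -
  have "(\<lambda>x. if x \<in> \<Omega> then u x else 0) \<in> borel_measurable lebesgue"
    using u op by (subst borel_measurable_if) (auto simp: L2_def)
  then obtain v where v: "v \<in> borel_measurable lborel" "AE x in lborel. (if x \<in> \<Omega> then u x else 0) = v x"
    using completion_ex_borel_measurable_real by blast
  have "AE x in lebesgue_on \<Omega>. v x = u x"
    using v(2) op by (auto simp: AE_restrict_space_iff AE_completion_iff elim: eventually_mono)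
  then show thesis using that v(1) by simp
qed

theorem theorem2p6:
  fixes \<Omega> :: "'a::euclidean_space set" and \<theta> :: 'a and u g :: "'a \<Rightarrow> real"
  assumes "open \<Omega>" and "bounded \<Omega>" and "norm \<theta> = 1"
    and "u \<in> W \<theta> \<Omega>" and "is_dir_trace \<theta> \<Omega> u g"
  shows "(\<forall>g' :: 'a \<Rightarrow> real.
            is_dir_trace \<theta> \<Omega> u g' \<longleftrightarrow> (AE z in dir_measure \<theta> \<Omega>. g' z = g z))
       \<and> (\<exists>h \<in> borel_measurable (restrict_space borel (frontier \<Omega>)).
            dir_trace \<theta> \<Omega> u = ae_equal (dir_measure \<theta> \<Omega>) `` {h})"
proof -
  note dom = assms(1-3)
  have "u \<in> L2 \<Omega>" using assms(4) by (simp add: W_def)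
  then obtain v where v: "v \<in> borel_measurable borel" "AE x in lebesgue_on \<Omega>. v x = u x"
    using L2_ex_borel_representative assms(1) by blast
  define h where "h = backward_limit \<theta> v"
  have trace_h: "AE z in dir_measure \<theta> \<Omega>. f z = h z" if "is_dir_trace \<theta> \<Omega> u f" for f
    unfolding h_def by (rule dir_trace_AE_eq_backward_limit[OF dom that v])
  note g_h = trace_h[OF assms(5)]
  have iff_g: "is_dir_trace \<theta> \<Omega> u g' \<longleftrightarrow> (AE z in dir_measure \<theta> \<Omega>. g' z = g z)" for g'
  proof
    assume "is_dir_trace \<theta> \<Omega> u g'"
    from trace_h[OF this] g_h show "AE z in dir_measure \<theta> \<Omega>. g' z = g z"
      by eventually_elim simp
  qed (rule dir_trace_AE_cong[OF dom assms(5)])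
  moreover have "h \<in> borel_measurable (restrict_space borel (frontier \<Omega>))"
    unfolding h_def by (rule measurable_restrict_space1[OF backward_limit_measurable[OF v(1)]])
  moreover have "dir_trace \<theta> \<Omega> u = ae_equal (dir_measure \<theta> \<Omega>) `` {h}"
  proof (rule set_eqI)
    fix g'
    have "(AE z in dir_measure \<theta> \<Omega>. g' z = g z) \<longleftrightarrow> (AE z in dir_measure \<theta> \<Omega>. h z = g' z)"
    proof
      assume "AE z in dir_measure \<theta> \<Omega>. g' z = g z"
      with g_h show "AE z in dir_measure \<theta> \<Omega>. h z = g' z" by eventually_elim simp
    next
      assume "AE z in dir_measure \<theta> \<Omega>. h z = g' z"
      with g_h show "AE z in dir_measure \<theta> \<Omega>. g' z = g z" by eventually_elim simp
    qed
    then show "g' \<in> dir_trace \<theta> \<Omega> u \<longleftrightarrow> g' \<in> ae_equal (dir_measure \<theta> \<Omega>) `` {h}"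
      by (simp add: dir_trace_def ae_equal_def iff_g)
  qed
  ultimately show ?thesis by blast
qed

end
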